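(* Let $r>1$ and let $\{\gamma_{1,k}\}_{k=0}^\infty,\{\gamma_{2,k}\}_{k=0}^\infty\subset[\gamma_{\min},\gamma_{\max}]$ with $\gamma_{\max}\ge\gamma_{\min}>0$. Assume: (1) $f:\mathbb{R}^n\to(-\infty,\infty]$ is continuously differentiable on $\operatorname{int}\operatorname{dom}f$, bounded from below on $\mathbb{L}^n_+$, and lower semicontinuous; (2) $\mathbb{L}^n_{++}\subset\operatorname{int}\operatorname{dom}f$ and $\operatorname{dom}f\cap\mathbb{L}^n_+\subset\operatorname{int}\operatorname{dom}f$; (3) $\nabla f$ is locally Lipschitz continuous on $\operatorname{int}\operatorname{dom}f$. For $k\ge0$, $x\in\mathbb{R}^n$, $y\in\mathbb{L}^n_{++}$, let $$D_k(x,y):=\gamma_{1,k}\langle y,Jy\rangle^r\left(-\log\frac{\langle x,Jx\rangle}{\langle y,Jy\rangle}+2\frac{\langle x,Jy\rangle}{\langle y,Jy\rangle}-2\right)+\frac{\gamma_{2,k}}{2}\|x-y\|^2,$$ where $J$ is the $n\times n$ diagonal matrix whose first $n-1$ diagonal entries are $-1$ and whose last diagonal entry is $1$. Let $\{x^k\}$ be a sequence generated by the algorithm GVDPGM (defined in the context) with these distances $D_k$, applied to the problem of minimizing $f(x)$ over $x\in\mathbb{L}^n_+$ (i.e. with $\mathbb{E}=\mathbb{R}^n$, $g=\delta_{\mathbb{L}^n_+}$, $\mathcal{C}=\mathbb{L}^n_{++}$). Then any accumulation point $x^*$ of $\{x^k\}$ is an F-stationary point of $\min_{x\in\mathbb{L}^n_+}f(x)$,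 i.e. $x^*\in\operatorname{dom}f\cap\mathbb{L}^n_+$ and $0\in\widehat{\partial}(f+\delta_{\mathbb{L}^n_+})(x^* )$.
   Context: $\mathbb{L}^n_+=\{x\in\mathbb{R}^n: x_n\ge(\sum_{j=1}^{n-1}x_j^2)^{1/2}\}$ is the second-order cone and $\mathbb{L}^n_{++}$ its interior; $\langle\cdot,\cdot\rangle$ is the dot product and $\|\cdot\|$ the Euclidean norm. Convention: $D_k(x,y)=\infty$ if $x\notin\mathbb{L}^n_{++}$ (i.e. $-\log\langle x,Jx\rangle$ is read as $\infty$ there). $\delta_{\mathcal A}$ is the indicator function of $\mathcal A$ ($0$ on $\mathcal A$, $\infty$ elsewhere); $\operatorname{dom}\phi:=\{x:\phi(x)<\infty\}$; $\operatorname{int}$ denotes interior. Algorithm GVDPGM (generalized variable distance proximal gradient method) for minimizing $F=f+g$: input $x^0\in\mathcal{C}\cap\operatorname{dom}g$, $F_0=F(x^0)$, $\beta>1$, $0<\sigma<1$, $0<p\le1$. For $k=0,1,2,\dots$ (run without termination): find the smallest $i\in\{0,1,2,\dots\}$ such that $F(x^{k,i})\le F_k-\sigma\beta^iD_k(x^{k,i},x^k)$, where $x^{k,i}$ is some element of $\operatorname{argmin}_{x\in\mathbb{E}}\{f(x^k)+\langle\nabla f(x^k),x-x^k\rangle+\beta^iD_k(x,x^k)+g(x)\}$. Denote this $i$ by $i_k$, choose $p_{k+1}\in[p,1]$, and set $x^{k+1}=x^{k,i_k}$, $F_{k+1}=p_{k+1}F(x^{k+1})+(1-p_{k+1})F_k$.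 Fréchet subdifferential at $x\in\operatorname{dom}\phi$: $\widehat{\partial}\phi(x)=\{v:\liminf_{y\to x,\,y\neq x}\frac{\phi(y)-\phi(x)-\langle v,y-x\rangle}{\|y-x\|}\ge0\}$. *)

theory Defs
  imports "HOL-Analysis.Analysis"
begin

definition effective_domain :: "('a \<Rightarrow> ereal) \<Rightarrow> 'a set" where
  "effective_domain \<phi> = {x. \<phi> x < \<infinity>}"

definition indicator_ext :: "'a set \<Rightarrow> 'a \<Rightarrow> ereal" where
  "indicator_ext A x = (if x \<in> A then 0 else \<infinity>)"

definition lower_semicontinuous :: "('a::topological_space \<Rightarrow> ereal) \<Rightarrow> bool" where
  "lower_semicontinuous \<phi> \<longleftrightarrow> (\<forall>x. \<phi> x \<le> Liminf (at x) \<phi>)"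

definition ext_differentiable_at :: "('a::real_inner \<Rightarrow> ereal) \<Rightarrow> 'a \<Rightarrow> bool" where
  "ext_differentiable_at \<phi> x \<longleftrightarrow> (\<lambda>y. real_of_ereal (\<phi> y)) differentiable (at x)"

text \<open>The gradient of an extended-valued function; it is only meaningful at interior points of the
  effective domain, where the function agrees locally with its real-valued version.\<close>
definition gradient :: "('a::real_inner \<Rightarrow> ereal) \<Rightarrow> 'a \<Rightarrow> 'a" where
  "gradient \<phi> x = (THE v. GDERIV (\<lambda>y. real_of_ereal (\<phi> y)) x :> v)"

definition continuously_differentiable_on :: "('a::real_inner \<Rightarrow> ereal) \<Rightarrow> 'a set \<Rightarrow> bool" where
  "continuously_differentiable_on \<phi> S \<longleftrightarrow>
     (\<forall>x\<in>S. ext_differentiable_at \<phi> x) \<and> continuous_on S (gradient \<phi>)"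

text \<open>The library notion has an additional time parameter, on which the function here does not
  depend.\<close>
definition locally_lipschitz_on :: "'a::metric_space set \<Rightarrow> ('a \<Rightarrow> 'b::metric_space) \<Rightarrow> bool" where
  "locally_lipschitz_on S h \<longleftrightarrow> local_lipschitz (UNIV :: real set) S (\<lambda>_. h)"

text \<open>The filter \<^term>\<open>at x\<close> excludes the point itself, as in the definition of the Frechet
  subdifferential.\<close>
definition frechet_subdifferential :: "('a::real_inner \<Rightarrow> ereal) \<Rightarrow> 'a \<Rightarrow> 'a set" where
  "frechet_subdifferential \<phi> x =
     {v. x \<in> effective_domain \<phi> \<and>
         0 \<le> Liminf (at x) (\<lambda>y. (\<phi> y - \<phi> x - ereal (v \<bullet> (y - x))) / ereal (norm (y - x)))}"

text \<open>Coordinates of \<open>\<real>\<^sup>n\<close> are indexed by a finite linearly ordered type; the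
  \<open>n\<close>-th coordinate is the one with the largest index.\<close>
definition last_index :: "'n::{finite,linorder}" where
  "last_index = Max UNIV"

definition soc :: "(real ^ 'n::{finite,linorder}) set" where
  "soc = {x. x $ last_index \<ge> sqrt (\<Sum>j\<in>UNIV - {last_index}. (x $ j)\<^sup>2)}"

definition soc_int :: "(real ^ 'n::{finite,linorder}) set" where
  "soc_int = interior soc"

definition J_mat :: "real ^ 'n::{finite,linorder} ^ 'n::{finite,linorder}" where
  "J_mat = (\<chi> i j. if i = j then (if i = last_index then 1 else - 1) else 0)"

text \<open>Here \<open>c1\<close>, \<open>c2\<close> are the weights of the logarithmic and the quadratic part. The value is
  relevant only for \<open>y\<close> in the interior of the cone.\<close>
definition soc_dist ::
  "real \<Rightarrow> real \<Rightarrow> real \<Rightarrow> real ^ 'n::{finite,linorder} \<Rightarrow> real ^ 'n::{finite,linorder} \<Rightarrow> ereal" where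
  "soc_dist r c1 c2 x y =
     (if x \<in> soc_int then
        ereal (c1 * (y \<bullet> (J_mat *v y)) powr r *
                 (- ln ((x \<bullet> (J_mat *v x)) / (y \<bullet> (J_mat *v y)))
                  + 2 * ((x \<bullet> (J_mat *v y)) / (y \<bullet> (J_mat *v y))) - 2)
               + c2 / 2 * (norm (x - y))\<^sup>2)
      else \<infinity>)"

definition gvdpgm_model ::
  "('a::euclidean_space \<Rightarrow> ereal) \<Rightarrow> ('a \<Rightarrow> ereal) \<Rightarrow> ('a \<Rightarrow> 'a \<Rightarrow> ereal) \<Rightarrow> real \<Rightarrow> 'a \<Rightarrow> 'a \<Rightarrow> ereal" where
  "gvdpgm_model f g D t y x =
     f y + ereal (gradient f y \<bullet> (x - y)) + ereal t * D x y + g x"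

text \<open>\<open>x\<close> is an infinite sequence of iterates. The witnesses are the reference
  values \<open>Fr k\<close>, the accepted line search exponents \<open>ix k\<close>, the averaging parameters \<open>q k\<close>, and
  the trial points \<open>z k i\<close>, which are constrained only for the exponents \<open>i \<le> ix k\<close> that the line
  search actually visits.\<close>
definition gvdpgm_sequence ::
  "('a::euclidean_space \<Rightarrow> ereal) \<Rightarrow> ('a \<Rightarrow> ereal) \<Rightarrow> 'a set \<Rightarrow> (nat \<Rightarrow> 'a \<Rightarrow> 'a \<Rightarrow> ereal)
   \<Rightarrow> real \<Rightarrow> real \<Rightarrow> real \<Rightarrow> (nat \<Rightarrow> 'a) \<Rightarrow> bool" where
  "gvdpgm_sequence f g C D \<beta> \<sigma> p x \<longleftrightarrow>
     x 0 \<in> C \<inter> effective_domain g \<and>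
     (\<exists>(Fr :: nat \<Rightarrow> ereal) (ix :: nat \<Rightarrow> nat) (q :: nat \<Rightarrow> real) (z :: nat \<Rightarrow> nat \<Rightarrow> 'a).
        Fr 0 = f (x 0) + g (x 0) \<and>
        (\<forall>k.
           (\<forall>i\<le>ix k. is_arg_min (gvdpgm_model f g (D k) (\<beta> ^ i) (x k)) (\<lambda>_. True) (z k i)) \<and>
           (\<forall>i<ix k. \<not> f (z k i) + g (z k i) \<le> Fr k - ereal (\<sigma> * \<beta> ^ i) * D k (z k i) (x k)) \<and>
           f (z k (ix k)) + g (z k (ix k))
             \<le> Fr k - ereal (\<sigma> * \<beta> ^ ix k) * D k (z k (ix k)) (x k) \<and>
           q (Suc k) \<in> {p..1} \<and>
           x (Suc k) = z k (ix k) \<and>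
           Fr (Suc k) = ereal (q (Suc k)) * (f (x (Suc k)) + g (x (Suc k)))
                          + ereal (1 - q (Suc k)) * Fr k))"

definition accumulation_point :: "(nat \<Rightarrow> 'a::topological_space) \<Rightarrow> 'a \<Rightarrow> bool" where
  "accumulation_point x a \<longleftrightarrow> (\<exists>s :: nat \<Rightarrow> nat. strict_mono s \<and> (x \<circ> s) \<longlonglongrightarrow> a)"

definition F_stationary_soc :: "(real ^ 'n::{finite,linorder} \<Rightarrow> ereal) \<Rightarrow> real ^ 'n::{finite,linorder} \<Rightarrow> bool" where
  "F_stationary_soc f a \<longleftrightarrow>
     a \<in> effective_domain f \<inter> soc \<and>
     0 \<in> frechet_subdifferential (\<lambda>x. f x + indicator_ext soc x) a"

end

theory Submission
  imports Defs
begin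

text \<open>Write \<open>q(u) = \<langle>u, Ju\<rangle>\<close> and \<open>t\<^sub>k\<close> for the accepted step parameter. The reverse
  Cauchy--Schwarz inequality on the cone makes the logarithmic part of the distance nonnegative, so
  the distance dominates the squared norm; sufficient decrease then forces
  \<open>x\<^bsub>k+1\<^esub> - x\<^sub>k \<rightarrow> 0\<close>. Near an accumulation point \<open>a\<close> the gradient is Lipschitz, so the descent
  inequality accepts every sufficiently large step parameter and \<open>t\<^sub>k\<close> stays bounded along the
  subsequence. In the limit of the optimality condition
  \<open>\<nabla>f(x\<^sub>k) + t\<^sub>k (2 \<gamma> q(x\<^sub>k)\<^sup>r (J x\<^sub>k / q(x\<^sub>k) - J x\<^bsub>k+1\<^esub> / q(x\<^bsub>k+1\<^esub>)) + \<gamma>' (x\<^bsub>k+1\<^esub> - x\<^sub>k)) = 0\<close>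
  there are two cases. If \<open>q(a) > 0\<close>, the two logarithmic terms cancel and \<open>\<nabla>f(a) = 0\<close>. If
  \<open>q(a) = 0\<close>, the first one vanishes because \<open>r > 1\<close>, so \<open>\<nabla>f(a)\<close> is a limit of nonnegative
  multiples of \<open>J x\<^bsub>k+1\<^esub>\<close>, hence nonnegative on the self-dual cone, while pairing with
  \<open>x\<^bsub>k+1\<^esub>\<close> gives \<open>\<langle>\<nabla>f(a), a\<rangle> = lim 2 t\<^sub>k \<gamma> q(x\<^sub>k)\<^sup>r = 0\<close>.\<close>

section \<open>Geometry of the second-order cone\<close>

abbreviation lorentz :: "real ^ 'n::{finite,linorder} \<Rightarrow> real ^ 'n::{finite,linorder} \<Rightarrow> real" where
  "lorentz u v \<equiv> u \<bullet> (J_mat *v v)"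

lemma J_mat_mult_component:
  "(J_mat *v u) $ i = (if i = last_index then u $ i else - u $ i)"
proof -
  have "(J_mat *v u) $ i
      = (\<Sum>j\<in>UNIV. (if i = j then (if i = last_index then 1 else - 1) else 0) * u $ j)"
    by (simp add: J_mat_def matrix_vector_mult_def)
  also have "\<dots> = (\<Sum>j\<in>UNIV. if j = i then (if i = last_index then u $ i else - u $ i) else 0)"
    by (rule sum.cong) auto
  finally show ?thesis
    by simp
qed

lemma lorentz_eq:
  "lorentz u v = u $ last_index * v $ last_index - (\<Sum>j\<in>UNIV - {last_index}. u $ j * v $ j)"
proof -
  have "lorentz u v = (\<Sum>j\<in>UNIV. u $ j * (J_mat *v v) $ j)"
    by (simp add: inner_vec_def)
  also have "\<dots> = u $ last_index * (J_mat *v v) $ last_index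
      + (\<Sum>j\<in>UNIV - {last_index}. u $ j * (J_mat *v v) $ j)"
    by (rule sum.remove) auto
  also have "(\<Sum>j\<in>UNIV - {last_index}. u $ j * (J_mat *v v) $ j)
      = (\<Sum>j\<in>UNIV - {last_index}. - (u $ j * v $ j))"
    by (rule sum.cong) (auto simp: J_mat_mult_component)
  finally show ?thesis
    by (simp add: J_mat_mult_component sum_negf)
qed

lemma lorentz_commute: "lorentz u v = lorentz v u"
  by (simp add: lorentz_eq mult.commute)

lemma lorentz_self_nonneg:
  assumes "u \<in> soc"
  shows "0 \<le> lorentz u u"
proof -
  have "sqrt (\<Sum>j\<in>UNIV - {last_index}. (u $ j)\<^sup>2) \<le> u $ last_index"
    using assms by (simp add: soc_def)
  then have "(\<Sum>j\<in>UNIV - {last_index}. (u $ j)\<^sup>2) \<le> (u $ last_index)\<^sup>2"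
    by (rule sqrt_le_D)
  then show ?thesis
    by (simp add: lorentz_eq power2_eq_square)
qed

text \<open>With \<open>a\<close>, \<open>b\<close> the norms of the first n-1 coordinates, the
  product of the two forms is a difference of squares,
  \<open>(u_n v_n - a b)^2 - (u_n b - a v_n)^2\<close>. Dropping the second square bounds its root
  by \<open>u_n v_n - a b\<close>, and the ordinary Cauchy-Schwarz inequality bounds that by
  \<open>lorentz u v\<close>.\<close>

lemma reverse_Cauchy_Schwarz_lorentz:
  assumes "u \<in> soc" "v \<in> soc"
  shows "sqrt (lorentz u u * lorentz v v) \<le> lorentz u v"
proof -
  let ?I = "UNIV - {last_index}"
  define a b where "a = sqrt (\<Sum>j\<in>?I. (u $ j)\<^sup>2)" and "b = sqrt (\<Sum>j\<in>?I. (v $ j)\<^sup>2)"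
  have ab: "0 \<le> a" "0 \<le> b" "a \<le> u $ last_index" "b \<le> v $ last_index"
    using assms by (auto simp: a_def b_def soc_def intro: sum_nonneg)
  have sq: "a\<^sup>2 = (\<Sum>j\<in>?I. (u $ j)\<^sup>2)" "b\<^sup>2 = (\<Sum>j\<in>?I. (v $ j)\<^sup>2)"
    by (auto simp: a_def b_def intro!: real_sqrt_pow2 sum_nonneg)
  have "(\<Sum>j\<in>?I. u $ j * v $ j) \<le> (\<Sum>j\<in>?I. \<bar>u $ j\<bar> * \<bar>v $ j\<bar>)"
    by (rule sum_mono) (metis abs_ge_self abs_mult)
  also have "\<dots> \<le> a * b"
    using L2_set_mult_ineq[of "\<lambda>j. u $ j" "\<lambda>j. v $ j" ?I] by (simp add: L2_set_def a_def b_def)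
  finally have le: "u $ last_index * v $ last_index - a * b \<le> lorentz u v"
    by (simp add: lorentz_eq)
  have "lorentz u u * lorentz v v
      = ((u $ last_index)\<^sup>2 - a\<^sup>2) * ((v $ last_index)\<^sup>2 - b\<^sup>2)"
    by (simp only: lorentz_eq sq) (simp add: power2_eq_square)
  also have "\<dots> = (u $ last_index * v $ last_index - a * b)\<^sup>2
      - (u $ last_index * b - a * v $ last_index)\<^sup>2"
    by (simp add: power2_eq_square algebra_simps)
  also have "\<dots> \<le> (u $ last_index * v $ last_index - a * b)\<^sup>2"
    by simp
  finally have "sqrt (lorentz u u * lorentz v v) \<le> u $ last_index * v $ last_index - a * b"
    by (rule real_le_lsqrt[rotated 1]) (use ab in \<open>simp add: mult_mono\<close>)
  with le show ?thesis
    by simp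
qed

lemma lorentz_nonneg:
  assumes "u \<in> soc" "v \<in> soc"
  shows "0 \<le> lorentz u v"
proof -
  have "0 \<le> sqrt (lorentz u u * lorentz v v)"
    using assms by (simp add: lorentz_self_nonneg)
  then show ?thesis
    using reverse_Cauchy_Schwarz_lorentz[OF assms] by (rule order_trans)
qed

lemma closed_soc: "closed soc"
  unfolding soc_def by (intro closed_Collect_le continuous_intros)

lemma open_soc_int: "open soc_int"
  by (simp add: soc_int_def)

lemma soc_int_subset_soc: "soc_int \<subseteq> soc"
  by (simp add: soc_int_def interior_subset)

lemma soc_int_lorentz_pos:
  assumes "u \<in> soc_int"
  shows "0 < lorentz u u"
proof -
  obtain e where e: "e > 0" "cball u e \<subseteq> soc"
    using assms unfolding soc_int_def mem_interior_cball by blast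
  \<comment> \<open>Lowering only the last coordinate by \<open>e\<close> stays in the cone, so at
    \<open>u\<close> the defining inequality holds with margin \<open>e\<close>.\<close>
  let ?v = "u - e *\<^sub>R axis last_index 1"
  have "?v \<in> soc"
    using e by (auto simp: dist_norm norm_axis_1)
  moreover have "(\<Sum>j\<in>UNIV - {last_index}. (?v $ j)\<^sup>2) = (\<Sum>j\<in>UNIV - {last_index}. (u $ j)\<^sup>2)"
    by (rule sum.cong) (auto simp: axis_def)
  ultimately have *: "sqrt (\<Sum>j\<in>UNIV - {last_index}. (u $ j)\<^sup>2) < u $ last_index"
    using e by (simp add: soc_def axis_def)
  then have "(\<Sum>j\<in>UNIV - {last_index}. (u $ j)\<^sup>2) < (u $ last_index)\<^sup>2"
    by (metis real_sqrt_less_iff real_sqrt_abs abs_ge_self order_less_le_trans)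
  then show ?thesis
    by (simp add: lorentz_eq power2_eq_square)
qed

lemma has_derivative_lorentz_self:
  "((\<lambda>w. lorentz w w) has_derivative (\<lambda>h. 2 * lorentz h w)) (at w)"
proof -
  have J: "((*v) J_mat has_derivative (*v) J_mat) (at w)"
    by (rule bounded_linear_imp_has_derivative) simp
  show ?thesis
    by (rule has_derivative_eq_rhs, rule has_derivative_inner[OF has_derivative_ident J])
      (auto simp: lorentz_commute)
qed

section \<open>The distance on the interior of the cone\<close>

text \<open>The finite branch of \<open>soc_dist\<close> without its case split, so that calculus
  and estimates take place in the reals.\<close>

definition soc_dist_real ::
  "real \<Rightarrow> real \<Rightarrow> real \<Rightarrow> real ^ 'n::{finite,linorder} \<Rightarrow> real ^ 'n::{finite,linorder} \<Rightarrow> real" where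
  "soc_dist_real r c1 c2 x y =
     c1 * lorentz y y powr r *
       (- ln (lorentz x x / lorentz y y) + 2 * (lorentz x y / lorentz y y) - 2)
     + c2 / 2 * (norm (x - y))\<^sup>2"

lemma soc_dist_eq:
  "soc_dist r c1 c2 x y = (if x \<in> soc_int then ereal (soc_dist_real r c1 c2 x y) else \<infinity>)"
  by (simp add: soc_dist_def soc_dist_real_def)

lemma soc_dist_real_self:
  assumes "y \<in> soc_int"
  shows "soc_dist_real r c1 c2 y y = 0"
  using soc_int_lorentz_pos[OF assms] by (simp add: soc_dist_real_def)

text \<open>For \<open>s = lorentz x x / lorentz y y\<close>, the reverse Cauchy-Schwarz inequality
  bounds the bracket below by \<open>2 * (sqrt s - 1 - ln (sqrt s))\<close>, which is nonnegative.
  Only the quadratic part then remains.\<close>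

lemma soc_dist_real_ge:
  assumes "x \<in> soc_int" "y \<in> soc_int" "0 \<le> c1"
  shows "c2 / 2 * (norm (x - y))\<^sup>2 \<le> soc_dist_real r c1 c2 x y"
proof -
  define s where "s = lorentz x x / lorentz y y"
  have pos: "0 < lorentz x x" "0 < lorentz y y"
    using assms by (auto intro: soc_int_lorentz_pos)
  then have s: "0 < s"
    by (simp add: s_def)
  have "sqrt s * lorentz y y = sqrt (lorentz x x * lorentz y y)"
    using pos by (simp add: s_def real_sqrt_divide real_sqrt_mult field_simps)
  also have "\<dots> \<le> lorentz x y"
    using assms soc_int_subset_soc by (intro reverse_Cauchy_Schwarz_lorentz) auto
  finally have "sqrt s \<le> lorentz x y / lorentz y y"
    using pos by (simp add: field_simps)
  moreover have "ln s = 2 * ln (sqrt s)"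
    using s by (simp add: ln_sqrt)
  moreover have "ln (sqrt s) \<le> sqrt s - 1"
    using s by (intro ln_le_minus_one) simp
  ultimately have "0 \<le> - ln s + 2 * (lorentz x y / lorentz y y) - 2"
    by simp
  then show ?thesis
    using assms unfolding soc_dist_real_def s_def by simp
qed

lemma has_derivative_soc_dist_real:
  assumes "w \<in> soc_int" "y \<in> soc_int"
  shows "((\<lambda>w. soc_dist_real r c1 c2 w y) has_derivative
    (\<lambda>h. h \<bullet> ((c1 * lorentz y y powr r) *\<^sub>R
        ((2 / lorentz y y) *\<^sub>R (J_mat *v y) - (2 / lorentz w w) *\<^sub>R (J_mat *v w))
      + c2 *\<^sub>R (w - y)))) (at w)"
proof -
  have pos: "0 < lorentz w w" "0 < lorentz y y"
    using assms by (auto intro: soc_int_lorentz_pos)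
  define a where "a = J_mat *v y"
  have form: "((\<lambda>w. lorentz w w / lorentz y y) has_derivative
      (\<lambda>h. 2 * lorentz h w / lorentz y y)) (at w)"
    by (rule bounded_linear.has_derivative[OF bounded_linear_divide has_derivative_lorentz_self])
  have log: "((\<lambda>w. ln (lorentz w w / lorentz y y)) has_derivative
      (\<lambda>h. 2 * lorentz h w / lorentz y y * inverse (lorentz w w / lorentz y y))) (at w)"
    by (rule has_derivative_ln[OF _ form]) (use pos in simp)
  have lin: "((\<lambda>w. 2 * (w \<bullet> a / lorentz y y)) has_derivative
      (\<lambda>h. 2 * (h \<bullet> a / lorentz y y))) (at w)"
    using has_derivative_mult_right[OF bounded_linear.has_derivative[OF bounded_linear_divide
          has_derivative_inner_left[OF has_derivative_ident]]] by simp
  have quad: "((\<lambda>w. (norm (w - y))\<^sup>2) has_derivative (\<lambda>h. 2 * (h \<bullet> (w - y)))) (at w)"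
    unfolding power2_norm_eq_inner
    by (auto intro!: derivative_eq_intros simp: inner_commute)
  show ?thesis
    unfolding soc_dist_real_def a_def[symmetric]
    by (rule has_derivative_eq_rhs[OF has_derivative_add[OF has_derivative_mult_right[OF
          has_derivative_diff[OF has_derivative_add[OF has_derivative_minus[OF
          log[folded a_def]] lin[folded a_def]] has_derivative_const]]
          has_derivative_mult_right[OF quad]]])
      (use pos in \<open>simp add: fun_eq_iff inner_add_right inner_diff_right field_simps a_def\<close>)
qed

text \<open>The descent inequality, with \<open>L\<close> instead of the sharp \<open>L / 2\<close>:
  the gradient variation is bounded by \<open>L * norm (b - a)\<close> on the whole segment. The
  line search argument needs only some fixed constant.\<close>

lemma lipschitz_gradient_upper_bound:
  fixes \<phi> :: "'a::real_inner \<Rightarrow> real"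
  assumes "convex S"
    and deriv: "\<And>u. u \<in> S \<Longrightarrow> (\<phi> has_derivative (\<lambda>h. h \<bullet> G u)) (at u)"
    and lip: "L-lipschitz_on S G"
    and "a \<in> S" "b \<in> S"
  shows "\<phi> b \<le> \<phi> a + G a \<bullet> (b - a) + L * (norm (b - a))\<^sup>2"
proof -
  have L: "0 \<le> L"
    using lip by (rule lipschitz_on_nonneg)
  have seg: "closed_segment a b \<subseteq> S"
    using assms by (simp add: closed_segment_subset)
  have "norm (\<phi> b - \<phi> a - (b - a) \<bullet> G a) \<le> norm (b - a) * (L * norm (b - a))"
  proof (rule differentiable_bound_linearization[where S = "closed_segment a b"
        and f' = "\<lambda>u h. h \<bullet> G u"])
    show "a + t *\<^sub>R (b - a) \<in> closed_segment a b" if "t \<in> {0..1}" for t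
      using that by (auto simp: in_segment algebra_simps intro!: exI[of _ t])
    show "(\<phi> has_derivative (\<lambda>h. h \<bullet> G u)) (at u within closed_segment a b)"
      if "u \<in> closed_segment a b" for u
      using deriv seg that by (meson has_derivative_at_withinI subsetD)
    show "onorm ((\<lambda>h. h \<bullet> G u) - (\<lambda>h. h \<bullet> G a)) \<le> L * norm (b - a)"
      if u: "u \<in> closed_segment a b" for u
    proof (rule onorm_bound)
      show "0 \<le> L * norm (b - a)"
        using L by simp
      fix h :: 'a
      have "norm (G u - G a) \<le> L * norm (u - a)"
        using lipschitz_onD[OF lip, of u a] u seg assms by (auto simp: dist_norm)
      also have "\<dots> \<le> L * norm (b - a)"
        using L segment_bound(1)[OF u] by (intro mult_left_mono) (auto simp: norm_minus_commute)
      finally have "norm h * norm (G u - G a) \<le> norm h * (L * norm (b - a))"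
        by (intro mult_left_mono) auto
      then show "norm (((\<lambda>h. h \<bullet> G u) - (\<lambda>h. h \<bullet> G a)) h) \<le> L * norm (b - a) * norm h"
        using Cauchy_Schwarz_ineq2[of h "G u - G a"] by (simp add: inner_diff_right algebra_simps)
    qed
  qed simp
  then show ?thesis
    by (simp add: inner_commute power2_eq_square abs_le_iff algebra_simps)
qed


section \<open>The iteration in real-valued form\<close>

text \<open>Here \<open>\<phi>\<close>, \<open>G\<close> and \<open>U\<close> stand for the
  real-valued objective, its gradient and the interior of its domain. All iterates and visited trial
  points lie in \<open>soc_int\<close>, so no infinite value occurs; \<open>z_min\<close> omits the
  constant term of the model.\<close>

locale soc_gvdpgm =
  fixes \<phi> :: "real ^ 'n::{finite,linorder} \<Rightarrow> real"
    and G :: "real ^ 'n::{finite,linorder} \<Rightarrow> real ^ 'n::{finite,linorder}"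
    and U :: "(real ^ 'n::{finite,linorder}) set"
    and r \<gamma>min \<gamma>max \<beta> \<sigma> p m :: real
    and \<gamma>1 \<gamma>2 :: "nat \<Rightarrow> real"
    and x :: "nat \<Rightarrow> real ^ 'n::{finite,linorder}"
    and z :: "nat \<Rightarrow> nat \<Rightarrow> real ^ 'n::{finite,linorder}"
    and Fr q :: "nat \<Rightarrow> real"
    and ix :: "nat \<Rightarrow> nat"
  assumes r: "1 < r"
    and \<gamma>min: "0 < \<gamma>min"
    and \<gamma>1: "\<And>k. \<gamma>1 k \<in> {\<gamma>min..\<gamma>max}"
    and \<gamma>2: "\<And>k. \<gamma>2 k \<in> {\<gamma>min..\<gamma>max}"
    and \<beta>: "1 < \<beta>" and \<sigma>: "0 < \<sigma>" "\<sigma> < 1" and p: "0 < p"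
    and U: "open U" "soc_int \<subseteq> U"
    and deriv: "\<And>u. u \<in> U \<Longrightarrow> (\<phi> has_derivative (\<lambda>h. h \<bullet> G u)) (at u)"
    and lip: "locally_lipschitz_on U G"
    and lower: "\<And>u. u \<in> soc_int \<Longrightarrow> m \<le> \<phi> u"
    and x_mem: "\<And>k. x k \<in> soc_int"
    and z_mem: "\<And>k i. i \<le> ix k \<Longrightarrow> z k i \<in> soc_int"
    and z_min: "\<And>k i w. i \<le> ix k \<Longrightarrow> w \<in> soc_int \<Longrightarrow>
      G (x k) \<bullet> (z k i - x k) + \<beta> ^ i * soc_dist_real r (\<gamma>1 k) (\<gamma>2 k) (z k i) (x k)
      \<le> G (x k) \<bullet> (w - x k) + \<beta> ^ i * soc_dist_real r (\<gamma>1 k) (\<gamma>2 k) w (x k)"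
    and reject: "\<And>k i. i < ix k \<Longrightarrow>
      Fr k - \<sigma> * \<beta> ^ i * soc_dist_real r (\<gamma>1 k) (\<gamma>2 k) (z k i) (x k) < \<phi> (z k i)"
    and accept: "\<And>k. \<phi> (x (Suc k))
      \<le> Fr k - \<sigma> * \<beta> ^ ix k * soc_dist_real r (\<gamma>1 k) (\<gamma>2 k) (x (Suc k)) (x k)"
    and q: "\<And>k. q (Suc k) \<in> {p..1}"
    and x_Suc: "\<And>k. x (Suc k) = z k (ix k)"
    and Fr_0: "Fr 0 = \<phi> (x 0)"
    and Fr_Suc: "\<And>k. Fr (Suc k) = q (Suc k) * \<phi> (x (Suc k)) + (1 - q (Suc k)) * Fr k"
begin

abbreviation d :: "nat \<Rightarrow> real ^ 'n::{finite,linorder} \<Rightarrow> real ^ 'n::{finite,linorder} \<Rightarrow> real" where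
  "d k \<equiv> soc_dist_real r (\<gamma>1 k) (\<gamma>2 k)"

abbreviation t :: "nat \<Rightarrow> real" where
  "t k \<equiv> \<beta> ^ ix k"

lemma power_\<beta>_ge_1: "1 \<le> \<beta> ^ i"
  using \<beta> by simp

lemma d_ge:
  assumes "u \<in> soc_int"
  shows "\<gamma>min / 2 * (norm (u - x k))\<^sup>2 \<le> d k u (x k)"
proof -
  have "\<gamma>min / 2 * (norm (u - x k))\<^sup>2 \<le> \<gamma>2 k / 2 * (norm (u - x k))\<^sup>2"
    using \<gamma>2[of k] by (intro mult_right_mono) auto
  also have "\<dots> \<le> d k u (x k)"
    using assms x_mem \<gamma>1[of k] \<gamma>min by (intro soc_dist_real_ge) auto
  finally show ?thesis .
qed

lemma d_nonneg: "u \<in> soc_int \<Longrightarrow> 0 \<le> d k u (x k)"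
  using d_ge[of u k] \<gamma>min by (smt (verit) divide_nonneg_pos mult_nonneg_nonneg zero_le_power2)

section \<open>Decrease of the reference values and vanishing steps\<close>

lemma \<phi>_Suc_le_Fr: "\<phi> (x (Suc k)) \<le> Fr k"
proof -
  have "0 \<le> \<sigma> * t k * d k (x (Suc k)) (x k)"
    using \<sigma> \<beta> d_nonneg[OF x_mem] by simp
  then show ?thesis
    using accept[of k] by linarith
qed

text \<open>After the start, \<open>Fr k\<close> is a convex combination of
  \<open>\<phi> (x k)\<close> and the previous reference value, which is at least
  \<open>\<phi> (x k)\<close>.\<close>

lemma \<phi>_le_Fr: "\<phi> (x k) \<le> Fr k"
proof (cases k)
  case (Suc l)
  have "(1 - q k) * \<phi> (x k) \<le> (1 - q k) * Fr l"
    using q[of l] \<phi>_Suc_le_Fr[of l] Suc by (intro mult_left_mono) auto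
  then show ?thesis
    using Fr_Suc[of l] Suc by (simp add: algebra_simps)
qed (simp add: Fr_0)

text \<open>The averaging keeps the fraction \<open>q (Suc k)\<close>, at least \<open>p\<close>, of
  the decrease \<open>Fr k - \<phi> (x (Suc k))\<close> guaranteed by the acceptance test.\<close>

lemma Fr_decrease: "p * \<sigma> * t k * d k (x (Suc k)) (x k) \<le> Fr k - Fr (Suc k)"
proof -
  let ?D = "\<sigma> * t k * d k (x (Suc k)) (x k)"
  have D: "0 \<le> ?D"
    using \<sigma> \<beta> d_nonneg[OF x_mem] by simp
  have "p * ?D \<le> q (Suc k) * ?D"
    using q[of k] D by (intro mult_right_mono) auto
  also have "\<dots> \<le> q (Suc k) * (Fr k - \<phi> (x (Suc k)))"
    using q[of k] accept[of k] p by (intro mult_left_mono) auto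
  also have "\<dots> = Fr k - Fr (Suc k)"
    by (simp add: Fr_Suc algebra_simps)
  finally show ?thesis
    by (simp add: mult.assoc)
qed

lemma Fr_decseq: "decseq Fr"
proof (rule decseq_SucI)
  fix k
  have "0 \<le> p * \<sigma> * t k * d k (x (Suc k)) (x k)"
    using p \<sigma> \<beta> d_nonneg[OF x_mem] by simp
  then show "Fr (Suc k) \<le> Fr k"
    using Fr_decrease[of k] by linarith
qed

lemma \<phi>_le_initial: "\<phi> (x k) \<le> \<phi> (x 0)"
  using \<phi>_le_Fr[of k] Fr_decseq Fr_0 by (metis decseqD le0 order_trans)

text \<open>The reference values decrease and are bounded below, so their decrements tend to 0. As
  \<open>t k\<close> is at least 1 and the distance dominates the squared norm, the decrements
  control the squared steps.\<close>

lemma steps_tendsto_0: "(\<lambda>k. norm (x (Suc k) - x k)) \<longlonglongrightarrow> 0"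
proof -
  have "m \<le> Fr k" for k
    using lower[OF x_mem] \<phi>_le_Fr[of k] by (rule order_trans)
  then obtain l where "Fr \<longlonglongrightarrow> l"
    using decseq_convergent[OF Fr_decseq] by blast
  then have "(\<lambda>k. Fr k - Fr (Suc k)) \<longlonglongrightarrow> l - l"
    by (intro tendsto_diff LIMSEQ_Suc)
  then have lim: "(\<lambda>k. 2 / (p * \<sigma> * \<gamma>min) * (Fr k - Fr (Suc k))) \<longlonglongrightarrow> 0"
    by (intro tendsto_mult_right_zero) simp
  have "(norm (x (Suc k) - x k))\<^sup>2 \<le> 2 / (p * \<sigma> * \<gamma>min) * (Fr k - Fr (Suc k))" for k
  proof -
    have "\<gamma>min / 2 * (norm (x (Suc k) - x k))\<^sup>2 \<le> d k (x (Suc k)) (x k)"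
      by (rule d_ge[OF x_mem])
    also have "\<dots> \<le> t k * d k (x (Suc k)) (x k)"
      using mult_right_mono[OF power_\<beta>_ge_1 d_nonneg[OF x_mem]] by simp
    finally have "p * \<sigma> * (\<gamma>min / 2 * (norm (x (Suc k) - x k))\<^sup>2)
        \<le> p * \<sigma> * (t k * d k (x (Suc k)) (x k))"
      using p \<sigma> by (intro mult_left_mono) auto
    also have "\<dots> \<le> Fr k - Fr (Suc k)"
      using Fr_decrease[of k] by (simp add: mult.assoc)
    finally show ?thesis
      using p \<sigma> \<gamma>min by (simp add: field_simps)
  qed
  then have "(\<lambda>k. (norm (x (Suc k) - x k))\<^sup>2) \<longlonglongrightarrow> 0"
    by (intro tendsto_sandwich[OF _ _ tendsto_const lim]) auto
  then show ?thesis
    by simp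
qed

section \<open>Trial steps and boundedness of the accepted step parameters\<close>

lemma step_bound:
  assumes "i \<le> ix k"
  shows "\<beta> ^ i * d k (z k i) (x k) \<le> - (G (x k) \<bullet> (z k i - x k))"
    and "\<gamma>min * \<beta> ^ i * norm (z k i - x k) \<le> 2 * norm (G (x k))"
proof -
  let ?h = "z k i - x k"
  \<comment> \<open>The competitor in the model is \<open>x k\<close> itself, where both the linear
    term and the distance vanish.\<close>
  show *: "\<beta> ^ i * d k (z k i) (x k) \<le> - (G (x k) \<bullet> ?h)"
    using z_min[OF assms x_mem[of k]] soc_dist_real_self[OF x_mem[of k]] by simp
  have "\<beta> ^ i * (\<gamma>min / 2 * (norm ?h)\<^sup>2) \<le> \<beta> ^ i * d k (z k i) (x k)"
    using \<beta> d_ge[OF z_mem[OF assms], of k] by (intro mult_left_mono) auto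
  also have "\<dots> \<le> norm (G (x k)) * norm ?h"
    using * Cauchy_Schwarz_ineq2[of "G (x k)" ?h] by linarith
  finally have "norm ?h * (\<gamma>min * \<beta> ^ i * norm ?h) \<le> norm ?h * (2 * norm (G (x k)))"
    by (simp add: power2_eq_square algebra_simps)
  then show "\<gamma>min * \<beta> ^ i * norm ?h \<le> 2 * norm (G (x k))"
    by (cases "?h = 0") (auto simp: mult_le_cancel_left_pos)
qed

lemma lipschitz_cball:
  assumes "a \<in> U"
  obtains u L where "0 < u" "cball a u \<subseteq> U" "L-lipschitz_on (cball a u) G"
proof -
  obtain u L where u: "0 < u"
    and L: "\<And>s. s \<in> cball 0 u \<inter> (UNIV :: real set) \<Longrightarrow> L-lipschitz_on (cball a u \<inter> U) G"
    using local_lipschitzE[OF lip[unfolded locally_lipschitz_on_def], of 0 a] assms by auto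
  obtain v where v: "0 < v" "cball a v \<subseteq> U"
    using U assms open_contains_cball by blast
  have "L-lipschitz_on (cball a (min u v)) G"
    using L[of 0] u v by (auto elim!: lipschitz_on_subset)
  moreover have "cball a (min u v) \<subseteq> U"
    using v by auto
  ultimately show ?thesis
    using that u v by (metis min_less_iff_conj)
qed

text \<open>If \<open>t k\<close> were large with \<open>x k\<close> near \<open>a\<close>, the last
  rejected parameter \<open>\<tau> = t k / \<beta>\<close> would also be large. Its trial point
  would then stay in the Lipschitz ball, and the descent inequality would contradict the
  rejection.\<close>

lemma t_bounded:
  assumes lim: "(x \<circ> s) \<longlonglongrightarrow> a" and a: "a \<in> U"
  obtains T where "\<forall>\<^sub>F j in sequentially. t (s j) \<le> T"
proof -
  obtain u L where u: "0 < u" "cball a u \<subseteq> U" and L: "L-lipschitz_on (cball a u) G"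
    using lipschitz_cball[OF a] .
  have L0: "0 \<le> L"
    using L by (rule lipschitz_on_nonneg)
  \<comment> \<open>\<open>M\<close> bounds \<open>norm (G (x k))\<close> on the ball. The entries
    of \<open>K\<close> give, in order: \<open>\<tau>\<close> at least 1, a trial step of length at
    most \<open>u / 2\<close>, and absorption of the quadratic error
    \<open>L * (norm ?h)^2\<close>.\<close>
  define M where "M = norm (G a) + L * u"
  define K where "K = max 1 (max (4 * M / (\<gamma>min * u)) (2 * L / (\<gamma>min * (1 - \<sigma>))))"
  have bound: "t k \<le> \<beta> * K" if near: "dist (x k) a < u / 2" for k
  proof (rule ccontr)
    assume "\<not> t k \<le> \<beta> * K"
    then have gt: "\<beta> * K < \<beta> ^ ix k"
      by simp
    \<comment> \<open>A previous, rejected exponent exists because \<open>\<beta> * K\<close> is at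
      least 1, the value of \<open>t k\<close> for exponent 0.\<close>
    have "ix k \<noteq> 0"
    proof
      assume "ix k = 0"
      moreover have "1 \<le> \<beta> * K"
        using \<beta> mult_mono[of 1 \<beta> 1 K] by (simp add: K_def)
      ultimately show False
        using gt by simp
    qed
    then obtain i where i: "ix k = Suc i"
      using not0_implies_Suc by blast
    define \<tau> where "\<tau> = \<beta> ^ i"
    have \<tau>: "K < \<tau>"
      using gt \<beta> by (simp add: i \<tau>_def)
    then have \<tau>_ge: "1 \<le> \<tau>" "4 * M / (\<gamma>min * u) \<le> \<tau>" "2 * L / (\<gamma>min * (1 - \<sigma>)) \<le> \<tau>"
      by (auto simp: K_def)
    let ?h = "z k i - x k"
    have x_ball: "x k \<in> cball a u"
      using near u zero_le_dist[of "x k" a] by (simp add: dist_commute)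
    have "norm (G (x k) - G a) \<le> L * norm (x k - a)"
      using lipschitz_onD[OF L x_ball, of a] u by (simp add: dist_norm)
    also have "\<dots> \<le> L * u"
      using x_ball L0 by (intro mult_left_mono) (auto simp: dist_norm norm_minus_commute)
    finally have "norm (G (x k)) \<le> M"
      using norm_triangle_ineq2[of "G (x k)" "G a"] unfolding M_def by linarith
    moreover have "\<gamma>min * \<tau> * norm ?h \<le> 2 * norm (G (x k))"
      unfolding \<tau>_def using i by (intro step_bound) auto
    ultimately have "\<gamma>min * \<tau> * norm ?h \<le> 2 * M"
      by linarith
    also have "\<dots> \<le> \<gamma>min * \<tau> * (u / 2)"
      using \<tau>_ge(2) \<gamma>min u by (simp add: field_simps)
    finally have "norm ?h \<le> u / 2"
      using \<tau>_ge(1) \<gamma>min by (simp add: mult_le_cancel_left_pos)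
    then have z_ball: "z k i \<in> cball a u"
      using near dist_triangle[of a "z k i" "x k"] by (simp add: dist_norm norm_minus_commute)
    have z: "z k i \<in> soc_int"
      using i by (intro z_mem) auto
    \<comment> \<open>The share \<open>1 - \<sigma>\<close> of the distance term pays for the
      quadratic error; the share \<open>\<sigma>\<close> that is left is exactly the decrease
      required for acceptance.\<close>
    have "L * (norm ?h)\<^sup>2 \<le> (1 - \<sigma>) * \<tau> * (\<gamma>min / 2 * (norm ?h)\<^sup>2)"
    proof -
      have "L \<le> (1 - \<sigma>) * \<tau> * (\<gamma>min / 2)"
        using \<tau>_ge(3) \<sigma> \<gamma>min by (simp add: field_simps)
      then have "L * (norm ?h)\<^sup>2 \<le> (1 - \<sigma>) * \<tau> * (\<gamma>min / 2) * (norm ?h)\<^sup>2"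
        by (rule mult_right_mono) simp
      then show ?thesis
        by (simp add: mult.assoc)
    qed
    also have "\<dots> \<le> (1 - \<sigma>) * \<tau> * d k (z k i) (x k)"
      using \<sigma> \<tau>_ge(1) d_ge[OF z, of k] by (intro mult_left_mono) auto
    finally have quad: "L * (norm ?h)\<^sup>2 \<le> (1 - \<sigma>) * \<tau> * d k (z k i) (x k)" .
    have "\<phi> (z k i) \<le> \<phi> (x k) + G (x k) \<bullet> ?h + L * (norm ?h)\<^sup>2"
      using u(2) deriv x_ball z_ball by (intro lipschitz_gradient_upper_bound[OF _ _ L]) auto
    moreover have "\<tau> * d k (z k i) (x k) \<le> - (G (x k) \<bullet> ?h)"
      unfolding \<tau>_def using i by (intro step_bound) auto
    ultimately have "\<phi> (z k i) \<le> \<phi> (x k) - \<sigma> * \<tau> * d k (z k i) (x k)"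
      using quad by (simp add: algebra_simps)
    \<comment> \<open>Since \<open>\<phi> (x k)\<close> is at most \<open>Fr k\<close>, decrease
      from the function value passes the test against the reference value.\<close>
    then show False
      using reject[of i k] \<phi>_le_Fr[of k] i by (simp add: \<tau>_def)
  qed
  have "\<forall>\<^sub>F j in sequentially. dist ((x \<circ> s) j) a < u / 2"
    using tendstoD[OF lim, of "u / 2"] u by simp
  then have "\<forall>\<^sub>F j in sequentially. t (s j) \<le> \<beta> * K"
    by eventually_elim (simp add: bound)
  then show ?thesis
    by (rule that)
qed

section \<open>Optimality condition of the subproblem and its limit\<close>

lemma optimality:
  assumes "i \<le> ix k"
  shows "G (x k) + \<beta> ^ i *\<^sub>R ((\<gamma>1 k * lorentz (x k) (x k) powr r) *\<^sub>R
        ((2 / lorentz (x k) (x k)) *\<^sub>R (J_mat *v x k)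
          - (2 / lorentz (z k i) (z k i)) *\<^sub>R (J_mat *v z k i))
      + \<gamma>2 k *\<^sub>R (z k i - x k)) = 0" (is "G (x k) + \<beta> ^ i *\<^sub>R ?g = 0")
proof -
  let ?h = "\<lambda>w. (w - x k) \<bullet> G (x k) + \<beta> ^ i * d k w (x k)"
  have lin: "((\<lambda>w. (w - x k) \<bullet> G (x k)) has_derivative (\<lambda>h. h \<bullet> G (x k))) (at (z k i))"
    by (auto intro!: derivative_eq_intros)
  have "(?h has_derivative (\<lambda>h. h \<bullet> G (x k) + \<beta> ^ i * (h \<bullet> ?g))) (at (z k i))"
    by (rule has_derivative_add[OF lin has_derivative_mult_right
          [OF has_derivative_soc_dist_real[OF z_mem[OF assms] x_mem]]])
  \<comment> \<open>The cone interior is open, so minimality over it is an unconstrained local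
    minimum and the derivative vanishes.\<close>
  moreover have "\<forall>\<^sub>F w in at (z k i). ?h (z k i) \<le> ?h w"
  proof -
    have "\<forall>\<^sub>F w in at (z k i). w \<in> soc_int"
      using open_soc_int z_mem[OF assms] by (rule eventually_at_in_open')
    then show ?thesis
      by eventually_elim (use z_min[OF assms] in \<open>simp add: inner_commute\<close>)
  qed
  ultimately have "(\<lambda>h. h \<bullet> G (x k) + \<beta> ^ i * (h \<bullet> ?g)) = (\<lambda>h. 0)"
    by (rule has_derivative_local_min)
  then have "h \<bullet> (G (x k) + \<beta> ^ i *\<^sub>R ?g) = 0" for h
    by (simp only: fun_eq_iff inner_add_right inner_scaleR_right)
  then show ?thesis
    using inner_eq_zero_iff by blast
qed


lemma G_continuous_on: "continuous_on U G"
  using lip unfolding locally_lipschitz_on_def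
  by (rule local_lipschitz_continuous_on[OF _ UNIV_I])

text \<open>The inequality is trivial if \<open>G a = 0\<close>; otherwise it suffices that
  \<open>G a\<close> is nonnegative on the cone and orthogonal to \<open>a\<close>. Passing to the
  limit in \<open>optimality\<close> gives the first alternative for \<open>lorentz a a\<close>
  nonzero and the second for \<open>lorentz a a = 0\<close>.\<close>

lemma accumulation_point_variational:
  assumes s: "strict_mono s" and lim: "(x \<circ> s) \<longlonglongrightarrow> a" and a: "a \<in> U" and v: "v \<in> soc"
  shows "0 \<le> G a \<bullet> (v - a)"
proof -
  define X Y where "X = (\<lambda>j. x (s j))" and "Y = (\<lambda>j. x (Suc (s j)))"
  define c where "c = (\<lambda>j. \<gamma>1 (s j) * lorentz (X j) (X j) powr r)"
  \<comment> \<open>\<open>N u\<close> is the gradient of \<open>ln (lorentz u u)\<close>.\<close>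
  define N where "N = (\<lambda>u :: real ^ 'n::{finite,linorder}. (2 / lorentz u u) *\<^sub>R (J_mat *v u))"
  obtain T where T: "\<forall>\<^sub>F j in sequentially. t (s j) \<le> T"
    using t_bounded[OF lim a] .
  have X: "X \<longlonglongrightarrow> a"
    using lim by (simp add: X_def o_def)
  have step: "(\<lambda>j. norm (Y j - X j)) \<longlonglongrightarrow> 0"
    using LIMSEQ_subseq_LIMSEQ[OF steps_tendsto_0 s] by (simp add: X_def Y_def o_def)
  have Y: "Y \<longlonglongrightarrow> a"
    using tendsto_add[OF tendsto_norm_zero_cancel[OF step] X] by simp
  have a_soc: "a \<in> soc"
    by (rule closed_sequentially[OF closed_soc _ X])
      (use x_mem soc_int_subset_soc in \<open>auto simp: X_def\<close>)
  have J: "(\<lambda>j. J_mat *v w j) \<longlonglongrightarrow> J_mat *v a" if "w \<longlonglongrightarrow> a" for w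
    by (rule bounded_linear.tendsto[OF matrix_vector_mul_bounded_linear that])
  have Q: "(\<lambda>j. lorentz (w j) (w j)) \<longlonglongrightarrow> lorentz a a" if "w \<longlonglongrightarrow> a" for w
    by (rule tendsto_inner[OF that J[OF that]])
  have GX: "(\<lambda>j. G (X j)) \<longlonglongrightarrow> G a"
    using G_continuous_on U a X by (metis continuous_on_eq_continuous_at isCont_tendsto_compose)
  have pos: "0 < lorentz (X j) (X j)" "0 < lorentz (Y j) (Y j)" for j
    using x_mem by (auto simp: X_def Y_def intro: soc_int_lorentz_pos)
  have c: "0 \<le> c j" "c j \<le> \<gamma>max * lorentz (X j) (X j) powr r" for j
    using \<gamma>1[of "s j"] \<gamma>min by (auto simp: c_def intro: mult_right_mono)
  have opt: "G (X j) + t (s j) *\<^sub>R (c j *\<^sub>R (N (X j) - N (Y j)) + \<gamma>2 (s j) *\<^sub>R (Y j - X j)) = 0"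
    for j
    using optimality[of "ix (s j)" "s j"] by (simp add: X_def Y_def c_def N_def x_Suc)
  \<comment> \<open>\<open>w\<close> is left open because the cases differ in which terms vanish:
    \<open>N (X j) - N (Y j)\<close> when \<open>lorentz a a\<close> is nonzero,
    \<open>N (X j)\<close> alone when it is zero.\<close>
  have remainder: "(\<lambda>j. t (s j) *\<^sub>R (c j *\<^sub>R w j + \<gamma>2 (s j) *\<^sub>R (Y j - X j))) \<longlonglongrightarrow> 0"
    if w: "(\<lambda>j. lorentz (X j) (X j) powr r * norm (w j)) \<longlonglongrightarrow> 0" for w
  proof (rule Lim_null_comparison)
    show "\<forall>\<^sub>F j in sequentially. norm (t (s j) *\<^sub>R (c j *\<^sub>R w j + \<gamma>2 (s j) *\<^sub>R (Y j - X j)))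
      \<le> T * (\<gamma>max * (lorentz (X j) (X j) powr r * norm (w j)) + \<gamma>max * norm (Y j - X j))"
      using T
    proof eventually_elim
      case (elim j)
      have "norm (c j *\<^sub>R w j + \<gamma>2 (s j) *\<^sub>R (Y j - X j))
          \<le> c j * norm (w j) + \<gamma>2 (s j) * norm (Y j - X j)"
        using norm_triangle_ineq[of "c j *\<^sub>R w j" "\<gamma>2 (s j) *\<^sub>R (Y j - X j)"]
          c(1)[of j] \<gamma>2[of "s j"] \<gamma>min by simp
      also have "\<dots> \<le> \<gamma>max * lorentz (X j) (X j) powr r * norm (w j) + \<gamma>max * norm (Y j - X j)"
        using c(2)[of j] \<gamma>2[of "s j"] by (intro add_mono mult_right_mono) auto
      finally have "norm (c j *\<^sub>R w j + \<gamma>2 (s j) *\<^sub>R (Y j - X j))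
          \<le> \<gamma>max * (lorentz (X j) (X j) powr r * norm (w j)) + \<gamma>max * norm (Y j - X j)"
        by (simp add: mult.assoc)
      then show ?case
        using elim power_\<beta>_ge_1[of "ix (s j)"] by (simp add: mult_mono)
    qed
    show "(\<lambda>j. T * (\<gamma>max * (lorentz (X j) (X j) powr r * norm (w j))
        + \<gamma>max * norm (Y j - X j))) \<longlonglongrightarrow> 0"
      using tendsto_mult_left[OF tendsto_add[OF tendsto_mult_left[OF w] tendsto_mult_left[OF step]]]
      by simp
  qed
  show ?thesis
  proof (cases "lorentz a a = 0")
    case False
    have N: "(\<lambda>j. N (w j)) \<longlonglongrightarrow> N a" if "w \<longlonglongrightarrow> a" for w
      unfolding N_def by (intro tendsto_scaleR tendsto_divide tendsto_const Q J that False)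
    have "(\<lambda>j. lorentz (X j) (X j) powr r * norm (N (X j) - N (Y j)))
        \<longlonglongrightarrow> lorentz a a powr r * norm (N a - N a)"
      by (intro tendsto_mult tendsto_powr tendsto_const tendsto_norm tendsto_diff Q N X Y False)
    then have "(\<lambda>j. G (X j) + t (s j) *\<^sub>R (c j *\<^sub>R (N (X j) - N (Y j))
        + \<gamma>2 (s j) *\<^sub>R (Y j - X j))) \<longlonglongrightarrow> G a + 0"
      by (intro tendsto_add GX remainder) simp
    then have "G a = 0"
      by (simp add: opt LIMSEQ_const_iff)
    then show ?thesis
      by simp
  next
    case True
    have powr_0: "(\<lambda>j. lorentz (X j) (X j) powr e) \<longlonglongrightarrow> 0" if "0 < e" for e
      using tendsto_powr'[OF Q[OF X] tendsto_const[of e]] that True pos(1)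
      by (simp add: less_imp_le)
    \<comment> \<open>The denominator in \<open>N\<close> costs one power, and the remaining
      exponent \<open>r - 1\<close> is positive.\<close>
    have "lorentz (X j) (X j) powr r * norm (N (X j))
        = 2 * (lorentz (X j) (X j) powr (r - 1) * norm (J_mat *v X j))" for j
      using pos(1)[of j] by (simp add: N_def powr_diff)
    moreover have "(\<lambda>j. 2 * (lorentz (X j) (X j) powr (r - 1) * norm (J_mat *v X j)))
        \<longlonglongrightarrow> 2 * (0 * norm (J_mat *v a))"
      using r by (intro tendsto_mult_left tendsto_mult powr_0 tendsto_norm J X) simp
    ultimately have "(\<lambda>j. G (X j) + t (s j) *\<^sub>R (c j *\<^sub>R N (X j)
        + \<gamma>2 (s j) *\<^sub>R (Y j - X j))) \<longlonglongrightarrow> G a + 0"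
      by (intro tendsto_add GX remainder) simp
    \<comment> \<open>The optimality condition with the \<open>N (Y j)\<close> term moved to the
      right, which exhibits \<open>G a\<close> as a limit of nonnegative multiples of
      \<open>J_mat *v Y j\<close>.\<close>
    moreover have "G (X j) + t (s j) *\<^sub>R (c j *\<^sub>R N (X j) + \<gamma>2 (s j) *\<^sub>R (Y j - X j))
        = (t (s j) * c j) *\<^sub>R N (Y j)" for j
      using opt[of j] by (simp add: algebra_simps add_eq_0_iff)
    ultimately have NY: "(\<lambda>j. (t (s j) * c j) *\<^sub>R N (Y j)) \<longlonglongrightarrow> G a"
      by simp
    have tc: "0 \<le> t (s j) * c j" for j
      using c(1)[of j] \<beta> by simp
    have dual: "0 \<le> G a \<bullet> v"
    proof (rule LIMSEQ_le_const[OF tendsto_inner[OF NY tendsto_const]], intro exI allI impI)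
      fix j
      have "0 \<le> lorentz v (Y j)"
        using v x_mem soc_int_subset_soc by (intro lorentz_nonneg) (auto simp: Y_def)
      then show "0 \<le> (t (s j) * c j) *\<^sub>R N (Y j) \<bullet> v"
        using tc[of j] pos(2)[of j] by (simp add: N_def inner_commute[of _ v])
    qed
    \<comment> \<open>Pairing \<open>N (Y j)\<close> with \<open>Y j\<close> cancels the denominator
      and gives the constant 2, so what remains is \<open>2 * t (s j) * c j\<close>, where
      \<open>t (s j)\<close> is bounded and \<open>c j\<close> tends to 0.\<close>
    have "(\<lambda>j. (t (s j) * c j) *\<^sub>R N (Y j) \<bullet> Y j) \<longlonglongrightarrow> 0"
    proof (rule Lim_null_comparison)
      show "\<forall>\<^sub>F j in sequentially. norm ((t (s j) * c j) *\<^sub>R N (Y j) \<bullet> Y j)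
        \<le> 2 * (T * (\<gamma>max * lorentz (X j) (X j) powr r))"
        using T
      proof eventually_elim
        case (elim j)
        have "(t (s j) * c j) *\<^sub>R N (Y j) \<bullet> Y j = 2 * (t (s j) * c j)"
          using pos(2)[of j] by (simp add: N_def inner_commute[of _ "Y j"])
        moreover have "t (s j) * c j \<le> T * (\<gamma>max * lorentz (X j) (X j) powr r)"
          using elim c[of j] power_\<beta>_ge_1[of "ix (s j)"] by (intro mult_mono) auto
        ultimately show ?case
          using tc[of j] by (simp only: real_norm_def)
      qed
      show "(\<lambda>j. 2 * (T * (\<gamma>max * lorentz (X j) (X j) powr r))) \<longlonglongrightarrow> 0"
        using r by (intro tendsto_mult_right_zero powr_0) simp
    qed
    then have "G a \<bullet> a = 0"
      using LIMSEQ_unique tendsto_inner[OF NY Y] by blast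
    then show ?thesis
      using dual by (simp add: inner_diff_right)
  qed
qed

end

section \<open>Stationarity of the extended-valued problem\<close>

text \<open>\<open>gradient\<close> is a definite description, so both existence and uniqueness of
  the representing vector are required. The vector is assembled from the derivative on the
  basis.\<close>

lemma has_derivative_gradient:
  fixes f :: "'a::euclidean_space \<Rightarrow> ereal"
  assumes "ext_differentiable_at f u"
  shows "((\<lambda>y. real_of_ereal (f y)) has_derivative (\<lambda>h. h \<bullet> gradient f u)) (at u)"
proof -
  let ?\<phi> = "\<lambda>y. real_of_ereal (f y)"
  obtain D where D: "(?\<phi> has_derivative D) (at u)"
    using assms unfolding ext_differentiable_at_def differentiable_def by blast
  define v where "v = (\<Sum>b\<in>Basis. D b *\<^sub>R b)"
  have "D h = h \<bullet> v" for h
  proof -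
    have "D h = (\<Sum>b\<in>Basis. (h \<bullet> b) * D b)"
      using Linear_Algebra.linear_componentwise[OF has_derivative_linear[OF D], of h 1] by simp
    then show ?thesis
      by (simp add: v_def inner_sum_right mult.commute)
  qed
  then have "D = (\<lambda>h. h \<bullet> v)" ..
  then have v: "GDERIV ?\<phi> u :> v"
    using D by (simp add: gderiv_def)
  moreover have "w = v" if "GDERIV ?\<phi> u :> w" for w
  proof -
    have "(\<lambda>h. h \<bullet> w) = (\<lambda>h. h \<bullet> v)"
      using that v unfolding gderiv_def by (rule has_derivative_unique)
    then have "h \<bullet> w = h \<bullet> v" for h
      by (rule fun_cong)
    then show ?thesis
      using vector_eq_ldot by blast
  qed
  ultimately have "gradient f u = v"
    unfolding gradient_def by (rule the_equality)
  then show ?thesis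
    using v by (simp add: gderiv_def)
qed

text \<open>Off \<open>S\<close> the difference quotient is infinite. On \<open>S\<close> the linear
  part is nonnegative by \<open>var\<close>, so the quotient is at least minus the differentiability
  error, which tends to 0.\<close>

lemma zero_in_frechet_subdifferential_add_indicator:
  fixes f :: "'a::real_inner \<Rightarrow> ereal"
  assumes not_MInf: "\<And>y. f y \<noteq> -\<infinity>"
    and a: "a \<in> interior (effective_domain f)" "a \<in> S"
    and deriv: "((\<lambda>y. real_of_ereal (f y)) has_derivative (\<lambda>h. h \<bullet> g)) (at a)"
    and var: "\<And>v. v \<in> S \<Longrightarrow> 0 \<le> g \<bullet> (v - a)"
  shows "0 \<in> frechet_subdifferential (\<lambda>y. f y + indicator_ext S y) a"
proof -
  let ?\<phi> = "\<lambda>y. real_of_ereal (f y)"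
  let ?Q = "\<lambda>y. (f y + indicator_ext S y - (f a + indicator_ext S a) - ereal (0 \<bullet> (y - a)))
    / ereal (norm (y - a))"
  have fin: "f y = ereal (?\<phi> y)" if "y \<in> interior (effective_domain f)" for y
    using that interior_subset[of "effective_domain f"] not_MInf[of y]
    by (auto simp: effective_domain_def ereal_real)
  have quot: "\<forall>\<^sub>F y in at a. ereal e < ?Q y" if "e < 0" for e
  proof -
    have "\<forall>\<^sub>F y in at a. norm (?\<phi> y - ?\<phi> a - (y - a) \<bullet> g) / norm (y - a) < - e"
      using deriv that unfolding has_derivative_iff_norm by (intro order_tendstoD(2)[of _ 0]) auto
    moreover have "\<forall>\<^sub>F y in at a. y \<in> interior (effective_domain f)"
      using a by (intro eventually_at_in_open') auto
    moreover have "\<forall>\<^sub>F y in at a. y \<noteq> a"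
      by (simp add: eventually_at_filter)
    ultimately show ?thesis
    proof eventually_elim
      case (elim y)
      have n: "0 < norm (y - a)"
        using elim by simp
      show ?case
      proof (cases "y \<in> S")
        case True
        have "\<bar>?\<phi> y - ?\<phi> a - (y - a) \<bullet> g\<bar> < - e * norm (y - a)"
          using elim(1) n by (simp add: field_simps)
        then have "e * norm (y - a) < ?\<phi> y - ?\<phi> a"
          using var[OF True] by (simp add: inner_commute)
        then have "e < (?\<phi> y - ?\<phi> a) / norm (y - a)"
          using n by (simp add: field_simps)
        moreover have "?Q y = ereal ((?\<phi> y - ?\<phi> a) / norm (y - a))"
          using True a n by (subst fin[OF elim(2)], subst fin[OF a(1)])
            (simp add: indicator_ext_def)
        ultimately show ?thesis
          by simp
      next
        case False
        have "?Q y = \<infinity>"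
          using False a n by (subst fin[OF elim(2)], subst fin[OF a(1)])
            (simp add: indicator_ext_def)
        then show ?thesis
          by simp
      qed
    qed
  qed
  \<comment> \<open>\<open>c\<close> is an extended real here; a real \<open>e\<close> between
    \<open>c\<close> and 0 reduces the claim to \<open>quot\<close>.\<close>
  have "\<forall>\<^sub>F y in at a. c < ?Q y" if "c < 0" for c
  proof -
    obtain e where e: "c < ereal e" "ereal e < 0"
      using ereal_dense2[OF \<open>c < 0\<close>] by blast
    then have "\<forall>\<^sub>F y in at a. ereal e < ?Q y"
      by (intro quot) simp
    then show ?thesis
      using e(1) by (auto elim: eventually_mono intro: less_trans)
  qed
  then have "0 \<le> Liminf (at a) ?Q"
    by (simp add: le_Liminf_iff)
  moreover have "a \<in> effective_domain (\<lambda>y. f y + indicator_ext S y)"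
    using a interior_subset[of "effective_domain f"]
    by (auto simp: effective_domain_def indicator_ext_def)
  ultimately show ?thesis
    by (simp add: frechet_subdifferential_def)
qed

lemma lower_semicontinuous_limit_le:
  assumes lsc: "lower_semicontinuous \<phi>" and lim: "X \<longlonglongrightarrow> a" and le: "\<And>j. \<phi> (X j) \<le> c"
  shows "\<phi> a \<le> c"
proof (rule ccontr)
  assume "\<not> \<phi> a \<le> c"
  then have c: "c < \<phi> a"
    by simp
  also have "\<phi> a \<le> Liminf (at a) \<phi>"
    using lsc by (simp add: lower_semicontinuous_def)
  finally have "\<forall>\<^sub>F y in at a. c < \<phi> y"
    by (rule less_LiminfD)
  \<comment> \<open>The \<open>Liminf\<close> ignores \<open>a\<close>, but the sequence may hit it;
    the assumed strict inequality at \<open>a\<close> fills the gap.\<close>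
  then have "\<forall>\<^sub>F y in nhds a. c < \<phi> y"
    using c by (auto simp: eventually_at_filter elim: eventually_mono)
  then have "\<forall>\<^sub>F j in sequentially. c < \<phi> (X j)"
    using lim by (rule eventually_compose_filterlim)
  then show False
    using le by (auto simp: eventually_sequentially not_less[symmetric])
qed

theorem theorem3p4:
  fixes f :: "real ^ 'n::{finite,linorder} \<Rightarrow> ereal"
    and r \<gamma>min \<gamma>max \<beta> \<sigma> p :: real
    and \<gamma>1 \<gamma>2 :: "nat \<Rightarrow> real"
    and x :: "nat \<Rightarrow> real ^ 'n::{finite,linorder}"
    and xstar :: "real ^ 'n::{finite,linorder}"
  assumes "r > 1"
    and "\<gamma>min > 0" "\<gamma>max \<ge> \<gamma>min"
    and "\<And>k. \<gamma>1 k \<in> {\<gamma>min..\<gamma>max}" "\<And>k. \<gamma>2 k \<in> {\<gamma>min..\<gamma>max}"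
    and "\<beta> > 1" "0 < \<sigma>" "\<sigma> < 1" "0 < p" "p \<le> 1"
    and "\<And>y. f y \<noteq> -\<infinity>"
    and "continuously_differentiable_on f (interior (effective_domain f))"
    and "\<exists>m::real. \<forall>y\<in>soc. ereal m \<le> f y"
    and "lower_semicontinuous f"
    and "soc_int \<subseteq> interior (effective_domain f)"
    and "effective_domain f \<inter> soc \<subseteq> interior (effective_domain f)"
    and "locally_lipschitz_on (interior (effective_domain f)) (gradient f)"
    and "gvdpgm_sequence f (indicator_ext soc) soc_int
           (\<lambda>k. soc_dist r (\<gamma>1 k) (\<gamma>2 k)) \<beta> \<sigma> p x"
    and "accumulation_point x xstar"
  shows "F_stationary_soc f xstar"
proof -
  let ?U = "interior (effective_domain f)"
  let ?g = "indicator_ext soc"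
  let ?D = "\<lambda>k. soc_dist r (\<gamma>1 k) (\<gamma>2 k)"
  let ?d = "\<lambda>k. soc_dist_real r (\<gamma>1 k) (\<gamma>2 k)"
  define \<phi> where "\<phi> = (\<lambda>y. real_of_ereal (f y))"
  have f: "f y = ereal (\<phi> y)" if "y \<in> ?U" for y
    using that interior_subset[of "effective_domain f"] assms(11)[of y]
    by (auto simp: effective_domain_def \<phi>_def ereal_real)
  have g: "?g y = 0" if "y \<in> soc_int" for y
    using that soc_int_subset_soc by (auto simp: indicator_ext_def)
  have f_int: "f y = ereal (\<phi> y)" if "y \<in> soc_int" for y
    using f that assms(15) by blast
  have deriv: "(\<phi> has_derivative (\<lambda>h. h \<bullet> gradient f u)) (at u)" if "u \<in> ?U" for u
    unfolding \<phi>_def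
    using assms(12) that by (intro has_derivative_gradient) (simp add: continuously_differentiable_on_def)
  obtain m :: real where m: "\<And>y. y \<in> soc \<Longrightarrow> ereal m \<le> f y"
    using assms(13) by blast
  obtain FR :: "nat \<Rightarrow> ereal" and ix q z where
    x_0: "x 0 \<in> soc_int"
    and FR_0: "FR 0 = f (x 0) + ?g (x 0)"
    and arg: "\<And>k i. i \<le> ix k \<Longrightarrow>
      is_arg_min (gvdpgm_model f ?g (?D k) (\<beta> ^ i) (x k)) (\<lambda>_. True) (z k i)"
    and reject: "\<And>k i. i < ix k \<Longrightarrow>
      \<not> f (z k i) + ?g (z k i) \<le> FR k - ereal (\<sigma> * \<beta> ^ i) * ?D k (z k i) (x k)"
    and accept: "\<And>k. f (z k (ix k)) + ?g (z k (ix k))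
      \<le> FR k - ereal (\<sigma> * \<beta> ^ ix k) * ?D k (z k (ix k)) (x k)"
    and q: "\<And>k. q (Suc k) \<in> {p..1}"
    and x_Suc: "\<And>k. x (Suc k) = z k (ix k)"
    and FR_Suc: "\<And>k. FR (Suc k) = ereal (q (Suc k)) * (f (x (Suc k)) + ?g (x (Suc k)))
      + ereal (1 - q (Suc k)) * FR k"
    using assms(18) unfolding gvdpgm_sequence_def by blast
  \<comment> \<open>Off \<open>soc_int\<close> the distance is infinite and its factor
    \<open>\<beta> ^ i\<close> positive, so the model value is infinite there.\<close>
  have model: "gvdpgm_model f ?g (?D k) (\<beta> ^ i) y w
      = (if w \<in> soc_int then ereal (\<phi> y + (gradient f y \<bullet> (w - y) + \<beta> ^ i * ?d k w y)) else \<infinity>)"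
    if "y \<in> soc_int" for k i y w
    using f_int[OF that] g[of w] assms(6)
    by (auto simp: gvdpgm_model_def soc_dist_eq indicator_ext_def add.assoc)
  have z_le: "gvdpgm_model f ?g (?D k) (\<beta> ^ i) (x k) (z k i)
      \<le> gvdpgm_model f ?g (?D k) (\<beta> ^ i) (x k) w" if "i \<le> ix k" for k i w
    using arg[OF that] by (simp add: is_arg_min_linorder)
  \<comment> \<open>The model is finite at \<open>x k\<close>, hence also at its minimizer, which
    must therefore lie in \<open>soc_int\<close>.\<close>
  have z_mem_if: "z k i \<in> soc_int" if "x k \<in> soc_int" "i \<le> ix k" for k i
    using z_le[OF that(2), of "x k"] that(1) by (auto simp: model split: if_splits)
  have x_mem: "x k \<in> soc_int" for k
    by (induction k) (auto simp: x_0 x_Suc intro: z_mem_if)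
  have z_mem: "z k i \<in> soc_int" if "i \<le> ix k" for k i
    using z_mem_if[OF x_mem that] .
  define Fr where "Fr = (\<lambda>k. real_of_ereal (FR k))"
  have Fr: "FR k = ereal (Fr k)" for k
  proof (induction k)
    case 0
    then show ?case
      by (simp add: Fr_def FR_0 f_int g x_mem)
  next
    case (Suc k)
    then show ?case
      by (simp add: Fr_def[THEN fun_cong, of "Suc k"] FR_Suc f_int g x_mem)
  qed
  interpret soc_gvdpgm \<phi> "gradient f" ?U r \<gamma>min \<gamma>max \<beta> \<sigma> p m \<gamma>1 \<gamma>2 x z Fr q ix
  proof unfold_locales
    show "m \<le> \<phi> u" if "u \<in> soc_int" for u
      using m[of u] f_int[OF that] that soc_int_subset_soc by auto
    show "gradient f (x k) \<bullet> (z k i - x k) + \<beta> ^ i * ?d k (z k i) (x k)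
        \<le> gradient f (x k) \<bullet> (w - x k) + \<beta> ^ i * ?d k w (x k)"
      if "i \<le> ix k" "w \<in> soc_int" for k i w
      using z_le[OF that(1), of w] that z_mem x_mem by (simp add: model)
    show "Fr k - \<sigma> * \<beta> ^ i * ?d k (z k i) (x k) < \<phi> (z k i)" if "i < ix k" for k i
      using reject[OF that] that z_mem[of i k] by (simp add: Fr f_int g soc_dist_eq)
    show "\<phi> (x (Suc k)) \<le> Fr k - \<sigma> * \<beta> ^ ix k * ?d k (x (Suc k)) (x k)" for k
      using accept[of k] x_mem[of "Suc k"] by (simp add: Fr f_int g soc_dist_eq flip: x_Suc)
    show "Fr 0 = \<phi> (x 0)"
      using Fr[of 0] by (simp add: FR_0 f_int g x_mem)
    show "Fr (Suc k) = q (Suc k) * \<phi> (x (Suc k)) + (1 - q (Suc k)) * Fr k" for k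
      using Fr[of "Suc k"] by (simp add: FR_Suc Fr[of k] f_int g x_mem)
  qed (use assms deriv x_mem z_mem q x_Suc in auto)
  obtain s where s: "strict_mono s" "(x \<circ> s) \<longlonglongrightarrow> xstar"
    using assms(19) unfolding accumulation_point_def by blast
  have soc: "xstar \<in> soc"
    by (rule closed_sequentially[OF closed_soc _ s(2)]) (use x_mem soc_int_subset_soc in auto)
  \<comment> \<open>Lower semicontinuity keeps the value at the limit finite; the domain assumption
    then places \<open>xstar\<close> in the interior of the domain even when it is on the boundary
    of the cone.\<close>
  have "f xstar \<le> ereal (\<phi> (x 0))"
    using assms(14) s(2)
    by (rule lower_semicontinuous_limit_le) (simp add: f_int x_mem \<phi>_le_initial)
  then have dom: "xstar \<in> effective_domain f"
    by (auto simp: effective_domain_def)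
  then have U: "xstar \<in> ?U"
    using soc assms(16) by blast
  have "0 \<in> frechet_subdifferential (\<lambda>y. f y + ?g y) xstar"
    using assms(11) U soc deriv[OF U, unfolded \<phi>_def] accumulation_point_variational[OF s U]
    by (rule zero_in_frechet_subdifferential_add_indicator)
  then show ?thesis
    using dom soc by (simp add: F_stationary_soc_def)
qed

end
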